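(* Let $q$ be a power of a prime $p$, let $n\ge1$, $\tau=p^{\nu_p(n)}$, and let $x^n-1=f_1^\tau\cdots f_r^\tau$ with $f_1,\ldots,f_r\in\mathbb{F}_q[x]$ distinct monic irreducible polynomials. Let $\alpha\in\mathbb{F}_{q^n}$ be normal over $\mathbb{F}_q$ and let $b$ be a positive integer with $b\le p$. Suppose $\gcd(n,q-1)=1$. Then the number of elements of $\mathbb{F}_{q^n}$ that are $(\alpha,b)$-sociable is $$q^{\frac{n(\tau-1)}{\tau}}\prod_{i=1}^r\left(q^{\deg(f_i)}-(b-1)\,\mathrm{ord}(\theta_i)-1\right),$$ where $\theta_i$ is a root of $f_i$, $1\le i\le r$.
   Context: $\nu_p(n)$ is the largest integer $e$ such that $p^e$ divides $n$; $\mathrm{ord}(\theta_i)$ is the multiplicative order of $\theta_i$ in an extension field of $\mathbb{F}_q$. An element $\alpha\in\mathbb{F}_{q^n}$ is normal (over $\mathbb{F}_q$) if $\alpha,\alpha^q,\ldots,\alpha^{q^{n-1}}$ are linearly independent over $\mathbb{F}_q$. For a positive integer $b\le p$, an element $\beta\in\mathbb{F}_{q^n}$ has normal $\alpha$-depth $b$ if $\beta,\beta-\alpha,\ldots,\beta-(b-1)\alpha$ are all normal over $\mathbb{F}_q$. The element $\beta$ is $(\alpha,b)$-sociable if $\beta^{q^i}$ has normal $\alpha$-depth $b$ for all $i\ge0$. *)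

theory Defs
  imports "Subresultants.More_Homomorphisms" "HOL-Computational_Algebra.Computational_Algebra"
    "HOL-Library.Cardinality"
begin

text \<open>
  Throughout, the type \<open>'k\<close> plays the role of \<open>F\<^sub>q\<close>, the type \<open>'l\<close> that of its extension
  \<open>F\<^bsub>q^n\<^esub>\<close>, and \<open>\<iota> :: 'k \<Rightarrow> 'l\<close> is the embedding that turns \<open>'l\<close> into a \<open>'k\<close>-vector space.
\<close>

text \<open>
  Linear independence in the library is a property of sets.  The injectivity clause makes it
  independence of the family \<open>a, a^q, \<dots>, a^(q^(n-1))\<close>, in which no repetitions are allowed.
\<close>

definition normal_over :: "('k::{field,finite} \<Rightarrow> 'l::field) \<Rightarrow> nat \<Rightarrow> 'l \<Rightarrow> bool" where
  "normal_over \<iota> n a \<longleftrightarrow>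
     inj_on (\<lambda>i. a ^ (CARD('k) ^ i)) {..<n} \<and>
     \<not> module.dependent (\<lambda>c x. \<iota> c * x) ((\<lambda>i. a ^ (CARD('k) ^ i)) ` {..<n})"

definition has_normal_depth ::
    "('k::{field,finite} \<Rightarrow> 'l::field) \<Rightarrow> nat \<Rightarrow> 'l \<Rightarrow> nat \<Rightarrow> 'l \<Rightarrow> bool" where
  "has_normal_depth \<iota> n \<alpha> b \<beta> \<longleftrightarrow> (\<forall>j<b. normal_over \<iota> n (\<beta> - of_nat j * \<alpha>))"

definition sociable ::
    "('k::{field,finite} \<Rightarrow> 'l::field) \<Rightarrow> nat \<Rightarrow> 'l \<Rightarrow> nat \<Rightarrow> 'l \<Rightarrow> bool" where
  "sociable \<iota> n \<alpha> b \<beta> \<longleftrightarrow> (\<forall>i. has_normal_depth \<iota> n \<alpha> b (\<beta> ^ (CARD('k) ^ i)))"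

text \<open>
  The value is meaningful only for elements of finite order, such as the roots of \<open>x^n - 1\<close>.
\<close>

definition mult_order :: "'a::field \<Rightarrow> nat" where
  "mult_order x = (LEAST k. 0 < k \<and> x ^ k = 1)"

end

theory Submission
  imports Defs
begin

text \<open>
  A polynomial \<open>g = \<Sum> g\<^sub>i x\<^sup>i\<close> over \<open>F\<^sub>q\<close> acts on \<open>F\<^bsub>q^n\<^esub>\<close> by substituting the \<open>q\<close>-Frobenius map for
  \<open>x\<close>: it sends \<open>a\<close> to \<open>\<Sum> g\<^sub>i a^(q^i)\<close>, written \<open>frob_poly g a\<close> below. Products act by composition and
  \<open>x^n - 1\<close> acts as zero, so this is a module structure over \<open>F\<^sub>q[x]/(x^n - 1)\<close>; an element is normal
  exactly when it generates a free module. If \<open>\<alpha>\<close> is normal, every \<open>\<beta>\<close> is therefore the image of \<open>\<alpha>\<close>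
  under exactly one \<open>g\<close> of degree below \<open>n\<close>, and \<open>\<beta>\<close> is normal iff \<open>g\<close> is a unit modulo \<open>x^n - 1\<close>,
  that is, iff no \<open>f\<^sub>i\<close> divides \<open>g\<close> (\<open>normal_over_frob_poly_iff\<close>).

  In these terms \<open>\<beta>^(q^e) - j \<alpha>\<close> corresponds to \<open>x^e g - j\<close>. So \<open>\<beta>\<close> is sociable iff, for every \<open>i\<close>, the
  value \<open>g(\<theta>\<^sub>i)\<close> in the field \<open>F\<^sub>q(\<theta>\<^sub>i)\<close> of size \<open>q^(deg f\<^sub>i)\<close> satisfies \<open>\<theta>\<^sub>i^e g(\<theta>\<^sub>i) \<noteq> j\<close> for all \<open>e\<close> and all
  \<open>j < b\<close>. The excluded values are \<open>0\<close> and the products \<open>j \<theta>\<^sub>i^e\<close> with \<open>1 \<le> j < b\<close>. These products are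
  pairwise distinct for different \<open>j\<close> and different powers of \<open>\<theta>\<^sub>i\<close>: a coincidence makes a quotient
  \<open>j/j'\<close> a power of \<open>\<theta>\<^sub>i\<close>, hence an \<open>n\<close>-th root of unity in \<open>F\<^sub>q\<close>, and \<open>gcd(n, q - 1) = 1\<close> leaves only
  \<open>1\<close>. Hence \<open>1 + (b - 1) ord(\<theta>\<^sub>i)\<close> residues modulo \<open>f\<^sub>i\<close> are excluded (\<open>card_excluded_residues\<close>).

  The conditions for the various \<open>i\<close> are independent by the Chinese remainder theorem
  (\<open>card_residue_conditions\<close>), which gives the product over \<open>i\<close> for residues modulo
  \<open>F = f\<^sub>1 \<cdots> f\<^sub>r\<close>. Each residue modulo \<open>F\<close> has \<open>q^(n - deg F)\<close> lifts of degree below \<open>n\<close>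
  (\<open>card_residue_lifts\<close>), and \<open>n = \<tau> deg F\<close>.
\<close>

section \<open>Finite fields and multiplicative orders\<close>

lemma prime_CHAR_finite_field: "prime CHAR('a::{field,finite})"
  by (simp add: prime_CHAR_semidom finite_imp_CHAR_pos)

text \<open>
  Translation by \<open>1\<close> permutes the field, so the sum of all its elements is unchanged when
  \<open>CARD('a)\<close> is added; hence the characteristic divides \<open>CARD('a)\<close>.
\<close>
lemma CHAR_eq_prime_if_CARD_power:
  assumes "prime p" and "CARD('a::{field,finite}) = p ^ m"
  shows "CHAR('a) = p"
proof -
  have "(\<Sum>x\<in>UNIV. x + 1) = (\<Sum>x\<in>UNIV. x :: 'a)"
    by (rule sum.reindex_bij_witness[of _ "\<lambda>x. x - 1" "\<lambda>x. x + 1"]) auto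
  then have "of_nat (p ^ m) = (0 :: 'a)"
    by (simp add: sum.distrib assms(2))
  then have "CHAR('a) dvd p ^ m"
    by (simp only: of_nat_eq_0_iff_char_dvd)
  then have "CHAR('a) dvd p"
    using prime_CHAR_finite_field[where ?'a = 'a] prime_dvd_power by blast
  then show ?thesis
    using assms(1) prime_CHAR_finite_field[where ?'a = 'a] primes_dvd_imp_eq by blast
qed

text \<open>
  Multiplication by \<open>c\<close> permutes the nonzero elements, so their product absorbs the factor
  \<open>c ^ (CARD('a) - 1)\<close>.
\<close>
lemma power_CARD_minus_1_eq_1:
  fixes c :: "'a::{field,finite}"
  assumes "c \<noteq> 0"
  shows "c ^ (CARD('a) - 1) = 1"
proof -
  have "(\<Prod>y\<in>UNIV - {0}. y) = (\<Prod>y\<in>UNIV - {0}. c * y)"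
    by (rule prod.reindex_bij_witness[of _ "\<lambda>y. c * y" "\<lambda>y. y / c"]) (use assms in auto)
  also have "\<dots> = c ^ (CARD('a) - 1) * (\<Prod>y\<in>UNIV - {0}. y)"
    by (simp add: prod.distrib)
  finally show ?thesis
    by simp
qed

lemma power_CARD_eq_same:
  fixes c :: "'a::{field,finite}"
  shows "c ^ CARD('a) = c"
proof (cases "c = 0")
  case False
  have "c ^ CARD('a) = c * c ^ (CARD('a) - 1)"
    by (metis Suc_pred' power_Suc zero_less_card_finite)
  with False show ?thesis
    by (simp only: power_CARD_minus_1_eq_1[OF False] mult_1_right)
qed (simp add: zero_power)

lemma eq_1_if_powers_eq_1_coprime:
  fixes c :: "'a::field"
  assumes "c ^ m = 1" and "c ^ n = 1" and "coprime m n"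
  shows "c = 1"
proof (cases "m = 0")
  case False
  obtain x y where "m * x = n * y + 1"
    using bezout_nat[OF False, of n] assms(3) by (auto simp: coprime_iff_gcd_eq_1)
  then have "(c ^ m) ^ x = c * (c ^ n) ^ y"
    by (simp flip: power_mult)
  with assms show ?thesis
    by simp
qed (use assms in simp)

lemma
  fixes x :: "'a::field"
  assumes "x ^ n = 1" and "n > 0"
  shows mult_order_pos: "mult_order x > 0"
    and power_mult_order: "x ^ mult_order x = 1"
  using LeastI[of "\<lambda>k. 0 < k \<and> x ^ k = 1" n] assms by (auto simp: mult_order_def)

lemma power_mod_mult_order:
  fixes x :: "'a::field"
  assumes "x ^ n = 1" and "n > 0"
  shows "x ^ (i mod mult_order x) = x ^ i"
proof -
  have "x ^ i = (x ^ mult_order x) ^ (i div mult_order x) * x ^ (i mod mult_order x)"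
    by (simp flip: power_mult power_add)
  then show ?thesis
    by (simp add: power_mult_order[OF assms])
qed

lemma inj_on_power_mult_order:
  fixes x :: "'a::field"
  assumes "x ^ n = 1" and "n > 0"
  shows "inj_on (\<lambda>i. x ^ i) {..<mult_order x}"
proof (rule linorder_inj_onI')
  fix i j assume "j \<in> {..<mult_order x}" and "i < j"
  show "x ^ i \<noteq> x ^ j"
  proof
    assume "x ^ i = x ^ j"
    also have "x ^ j = x ^ i * x ^ (j - i)"
      using \<open>i < j\<close> by (simp flip: power_add)
    finally have "x ^ (j - i) = 1"
      using assms by (auto simp: zero_power)
    then have "mult_order x \<le> j - i"
      unfolding mult_order_def using \<open>i < j\<close> by (intro Least_le) simp
    then show False
      using \<open>i < j\<close> \<open>j \<in> _\<close> by auto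
  qed
qed

section \<open>Counting polynomials over a finite field by their residues\<close>

text \<open>
  Bounding the coefficients instead of the degree makes the case \<open>n = 0\<close> the zero space, so that
  the set of residues modulo \<open>f\<close> is \<open>polys_below (degree f)\<close> for nonzero constants \<open>f\<close> as well.
\<close>
definition polys_below :: "nat \<Rightarrow> 'a::zero poly set" where
  "polys_below n = {g. \<forall>i\<ge>n. coeff g i = 0}"

lemma polys_below_iff: "g \<in> polys_below n \<longleftrightarrow> g = 0 \<or> degree g < n"
proof (cases "degree g < n")
  case True
  then show ?thesis
    by (simp add: polys_below_def coeff_eq_0)
next
  case False
  then have "g = 0" if "g \<in> polys_below n"
    using that leading_coeff_0_iff[of g] by (simp add: polys_below_def)
  with False show ?thesis
    by (auto simp: polys_below_def)
qed

lemma polys_below_diff: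
  fixes g h :: "'a::ab_group_add poly"
  shows "g \<in> polys_below n \<Longrightarrow> h \<in> polys_below n \<Longrightarrow> g - h \<in> polys_below n"
  by (simp add: polys_below_def)

lemma mod_in_polys_below:
  fixes f :: "'a::field poly"
  shows "f \<noteq> 0 \<Longrightarrow> g mod f \<in> polys_below (degree f)"
  using degree_mod_less[of f g] by (auto simp: polys_below_iff)

lemma polys_below_dvd_imp_0:
  fixes f :: "'a::field poly"
  shows "g \<in> polys_below (degree f) \<Longrightarrow> f dvd g \<Longrightarrow> g = 0"
  using dvd_imp_degree_le[of f g] by (force simp: polys_below_iff)

lemma card_polys_below:
  "finite (polys_below n :: 'a::{zero,finite} poly set) \<and>
   card (polys_below n :: 'a poly set) = CARD('a) ^ n"
proof (induction n)
  case 0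
  have "polys_below 0 = {0 :: 'a poly}"
    by (auto simp: polys_below_def poly_eq_iff)
  then show ?case
    by simp
next
  case (Suc n)
  have "polys_below (Suc n) = (\<lambda>(c, g). pCons c g) ` (UNIV \<times> (polys_below n :: 'a poly set))"
  proof (intro equalityI subsetI)
    fix h :: "'a poly" assume "h \<in> polys_below (Suc n)"
    then show "h \<in> (\<lambda>(c, g). pCons c g) ` (UNIV \<times> polys_below n)"
      by (cases h) (force simp: polys_below_def coeff_pCons split: nat.splits)
  qed (auto simp: polys_below_def coeff_pCons split: nat.splits)
  moreover have "inj_on (\<lambda>(c, g). pCons c g) (UNIV \<times> (polys_below n :: 'a poly set))"
    by (auto simp: inj_on_def)
  ultimately show ?case
    using Suc by (simp add: card_image card_cartesian_product)
qed

lemmas finite_polys_below = card_polys_below[THEN conjunct1]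

lemma card_preimage_bij_betw:
  assumes "bij_betw \<phi> X Y" and "T \<subseteq> Y"
  shows "card {x \<in> X. \<phi> x \<in> T} = card T"
proof -
  have "\<phi> ` {x \<in> X. \<phi> x \<in> T} = T"
    using assms by (auto simp: bij_betw_def)
  moreover have "inj_on \<phi> {x \<in> X. \<phi> x \<in> T}"
    using assms(1) by (auto simp: bij_betw_def inj_on_def)
  ultimately show ?thesis
    by (metis card_image)
qed

lemma bij_betw_if_inj_on_card:
  assumes "inj_on \<phi> X" and "\<phi> ` X \<subseteq> Y" and "finite Y" and "card X = card Y"
  shows "bij_betw \<phi> X Y"
  using assms by (simp add: bij_betw_def card_image card_subset_eq)

text \<open>
  The Chinese remainder theorem: \<open>h\<close> is determined by its two residues, since the difference of
  two candidates is a multiple of \<open>f * g\<close> of smaller degree, and both sides have the same size.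
  Coprimality enters only through primality of \<open>f\<close>: if \<open>f\<close> divides \<open>g * k\<close>, it divides \<open>k\<close>.
\<close>
lemma bij_betw_residue_pair:
  fixes f g :: "'a::{field,finite} poly"
  assumes "prime_elem f" and "\<not> f dvd g" and "g \<noteq> 0"
  shows "bij_betw (\<lambda>h. (h mod f, h mod g)) (polys_below (degree f + degree g))
           (polys_below (degree f) \<times> polys_below (degree g))"
proof (rule bij_betw_if_inj_on_card)
  show "inj_on (\<lambda>h. (h mod f, h mod g)) (polys_below (degree f + degree g))"
  proof (rule inj_onI, clarify)
    fix h h' assume *: "h \<in> polys_below (degree f + degree g)" "h' \<in> polys_below (degree f + degree g)"
      and "h mod f = h' mod f" "h mod g = h' mod g"
    then have "f dvd h - h'" "g dvd h - h'"
      by (simp_all add: mod_eq_dvd_iff)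
    then obtain k where k: "h - h' = g * k" "f dvd g * k"
      by (metis dvdE)
    with assms(1,2) have "f dvd k"
      by (simp add: prime_elem_dvd_mult_iff)
    then have "f * g dvd h - h'"
      by (simp add: k(1) mult.commute mult_dvd_mono)
    moreover have "h - h' \<in> polys_below (degree (f * g))"
      using * assms by (simp add: polys_below_diff degree_mult_eq prime_elem_not_zeroI)
    ultimately show "h = h'"
      using polys_below_dvd_imp_0 by fastforce
  qed
qed (use assms in \<open>auto simp: mod_in_polys_below finite_polys_below card_polys_below power_add prime_elem_not_zeroI\<close>)

lemma prime_elem_dvd_prod_iff:
  fixes p :: "'a::algebraic_semidom"
  assumes "prime_elem p" and "finite I"
  shows "p dvd prod f I \<longleftrightarrow> (\<exists>i\<in>I. p dvd f i)"
  using assms(2)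
  by induction (use assms(1) in \<open>auto simp: prime_elem_dvd_mult_iff prime_elem_not_unit\<close>)

text \<open>
  Induction on \<open>I\<close>: a residue modulo \<open>f i * prod f I\<close> amounts to a pair of independent residues, of
  which the first carries the condition for \<open>i\<close> and the second those for \<open>I\<close>.
\<close>
lemma card_residue_conditions:
  fixes f :: "'i \<Rightarrow> 'a::{field,finite} poly"
  assumes "finite I" and "\<And>i. i \<in> I \<Longrightarrow> prime_elem (f i)"
    and "\<And>i j. i \<in> I \<Longrightarrow> j \<in> I \<Longrightarrow> i \<noteq> j \<Longrightarrow> \<not> f i dvd f j"
    and "\<And>i. i \<in> I \<Longrightarrow> A i \<subseteq> polys_below (degree (f i))"
  shows "card {h \<in> polys_below (degree (prod f I)). \<forall>i\<in>I. h mod f i \<in> A i} = (\<Prod>i\<in>I. card (A i))"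
  using assms
proof (induction I)
  case empty
  then show ?case
    by (simp add: card_polys_below)
next
  case (insert i I)
  define S where "S = {h \<in> polys_below (degree (prod f I)). \<forall>j\<in>I. h mod f j \<in> A j}"
  have nz: "f i \<noteq> 0" "prod f I \<noteq> 0"
    using insert.hyps insert.prems(1) by (auto dest: prime_elem_not_zeroI)
  have "\<not> f i dvd prod f I"
    using insert.hyps insert.prems(1,2) by (auto simp: prime_elem_dvd_prod_iff)
  note bij = bij_betw_residue_pair[OF insert.prems(1)[OF insertI1] this nz(2)]
  have "h mod prod f I mod f j = h mod f j" if "j \<in> I" for h j
    using that insert.hyps by (intro mod_mod_cancel dvd_prodI)
  then have eq: "{h \<in> polys_below (degree (prod f (insert i I))). \<forall>j\<in>insert i I. h mod f j \<in> A j} =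
      {h \<in> polys_below (degree (f i) + degree (prod f I)).
         (h mod f i, h mod prod f I) \<in> A i \<times> S}"
    using insert.hyps nz by (auto simp: S_def degree_mult_eq mod_in_polys_below)
  have sub: "A i \<times> S \<subseteq> polys_below (degree (f i)) \<times> polys_below (degree (prod f I))"
    using insert.prems(3)[of i] by (auto simp: S_def)
  have "card {h \<in> polys_below (degree (prod f (insert i I))). \<forall>j\<in>insert i I. h mod f j \<in> A j} =
      card (A i \<times> S)"
    unfolding eq by (rule card_preimage_bij_betw[OF bij sub])
  also have "\<dots> = card (A i) * card S"
    by (simp add: card_cartesian_product)
  also have "card S = (\<Prod>j\<in>I. card (A j))"
    unfolding S_def using insert.prems by (intro insert.IH) auto
  finally show ?case
    using insert.hyps by simp
qed

text \<open>
  Division with remainder: the polynomials of degree below \<open>n\<close> with residue \<open>t\<close> are \<open>s * F + t\<close> with an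
  arbitrary quotient \<open>s\<close> of degree below \<open>n - degree F\<close>.
\<close>
lemma card_residue_lifts:
  fixes F :: "'a::{field,finite} poly"
  assumes "F \<noteq> 0" and "degree F \<le> n" and "B \<subseteq> polys_below (degree F)"
  shows "card {h \<in> polys_below n. h mod F \<in> B} = CARD('a) ^ (n - degree F) * card B"
proof -
  define \<phi> where "\<phi> = (\<lambda>(s, t). s * F + t)"
  let ?X = "polys_below (n - degree F) \<times> polys_below (degree F)"
  have residue: "t mod F = t" "t div F = 0" if "t \<in> polys_below (degree F)" for t
    using that assms(1) by (auto simp: polys_below_iff mod_poly_less div_poly_less)
  have range: "s * F + t \<in> polys_below n"
    if "s \<in> polys_below (n - degree F)" "t \<in> polys_below (degree F)" for s t
  proof (cases "s * F + t = 0")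
    case False
    have "degree (s * F) < n \<or> s = 0" "degree t < n \<or> t = 0"
      using that assms(1,2) by (auto simp: polys_below_iff degree_mult_eq)
    with False show ?thesis
      by (auto simp: polys_below_iff intro: degree_add_less)
  qed (simp add: polys_below_def)
  have "inj_on \<phi> ?X"
    by (rule inj_on_inverseI[where g = "\<lambda>h. (h div F, h mod F)"]) (auto simp: \<phi>_def residue assms(1))
  then have bij: "bij_betw \<phi> ?X (polys_below n)"
    using range assms(2)
    by (intro bij_betw_if_inj_on_card)
       (auto simp: \<phi>_def card_cartesian_product finite_polys_below card_polys_below
         simp flip: power_add)
  from card_preimage_bij_betw[OF bij, of "{h \<in> polys_below n. h mod F \<in> B}"]
  have "card {h \<in> polys_below n. h mod F \<in> B} =
      card {x \<in> ?X. \<phi> x \<in> polys_below n \<and> \<phi> x mod F \<in> B}"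
    by auto
  also have "{x \<in> ?X. \<phi> x \<in> polys_below n \<and> \<phi> x mod F \<in> B} = polys_below (n - degree F) \<times> B"
    using assms(3) range by (auto simp: \<phi>_def residue)
  finally show ?thesis
    by (simp add: card_cartesian_product card_polys_below)
qed

section \<open>Polynomials in the Frobenius map\<close>

locale finite_field_extension = field_hom \<iota>
  for \<iota> :: "'k::{field,finite} \<Rightarrow> 'l::{field,finite}" +
  fixes p m n :: nat
  assumes prime_p: "prime p" and card_k: "CARD('k) = p ^ m" and card_l: "CARD('l) = CARD('k) ^ n"
begin

text \<open>
  The value at \<open>a\<close> of the linearized polynomial associated with \<open>g\<close>, whose conventional
  \<open>q\<close>-associate is \<open>g\<close>.
\<close>
definition frob_poly :: "'k poly \<Rightarrow> 'l \<Rightarrow> 'l" where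
  "frob_poly g a = (\<Sum>i\<le>degree g. \<iota> (coeff g i) * a ^ (CARD('k) ^ i))"

lemma n_pos: "n > 0"
proof (rule ccontr)
  assume "\<not> n > 0"
  then have "CARD('l) = 1"
    using card_l by simp
  then obtain x :: 'l where "UNIV = {x}"
    by (auto simp: card_1_singleton_iff)
  then have "(0::'l) = 1"
    by (metis UNIV_I singletonD)
  then show False
    by simp
qed

lemma CHAR_k: "CHAR('k) = p"
  by (rule CHAR_eq_prime_if_CARD_power[OF prime_p card_k])

lemma CHAR_l: "CHAR('l) = p"
  by (rule CHAR_eq_prime_if_CARD_power[OF prime_p, of "m * n"]) (simp add: card_l card_k power_mult)

text \<open>
  This and \<open>frobenius_sum\<close> make the Frobenius map linear over the base field, which is what lets
  polynomials act through it.
\<close>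
lemma hom_power_CARD: "\<iota> c ^ CARD('k) = \<iota> c"
  by (simp add: power_CARD_eq_same flip: hom_power)

lemma frobenius_sum: "(\<Sum>i\<in>A. h i :: 'l) ^ CARD('k) = (\<Sum>i\<in>A. h i ^ CARD('k))"
  by (rule freshmans_dream_sum'[of _ m]) (simp_all add: CHAR_l prime_p card_k)

text \<open>
  A common summation range for polynomials of different degrees.
\<close>
lemma frob_poly_eq_sum:
  assumes "g \<in> polys_below N"
  shows "frob_poly g a = (\<Sum>i<N. \<iota> (coeff g i) * a ^ (CARD('k) ^ i))"
proof (cases "g = 0")
  case False
  then have "{..degree g} \<subseteq> {..<N}"
    using assms by (auto simp: polys_below_iff)
  then show ?thesis
    unfolding frob_poly_def
    by (intro sum.mono_neutral_left) (auto simp: coeff_eq_0)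
qed (simp add: frob_poly_def)

lemma frob_poly_pCons: "frob_poly (pCons c g) a = \<iota> c * a + frob_poly g a ^ CARD('k)"
proof -
  define N where "N = Suc (degree g)"
  have "g \<in> polys_below N" "pCons c g \<in> polys_below (Suc N)"
    by (auto simp: N_def polys_below_iff degree_pCons_eq_if)
  then show ?thesis
    by (simp add: frob_poly_eq_sum frobenius_sum sum.lessThan_Suc_shift power_mult_distrib
        hom_power_CARD ac_simps flip: power_mult del: sum.lessThan_Suc)
qed

lemma frob_poly_0 [simp]: "frob_poly 0 a = 0"
  by (simp add: frob_poly_def)

lemma frob_poly_add: "frob_poly (g + h) a = frob_poly g a + frob_poly h a"
proof -
  define N where "N = Suc (max (degree g) (degree h))"
  have "g \<in> polys_below N" "h \<in> polys_below N" "g + h \<in> polys_below N"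
    by (auto simp: N_def polys_below_iff less_Suc_eq_le degree_add_le)
  then show ?thesis
    by (simp add: frob_poly_eq_sum hom_add sum.distrib distrib_right)
qed

lemma frob_poly_smult: "frob_poly (Polynomial.smult c g) a = \<iota> c * frob_poly g a"
  by (simp add: frob_poly_def hom_mult sum_distrib_left mult.assoc)

lemma frob_poly_diff: "frob_poly (g - h) a = frob_poly g a - frob_poly h a"
  using frob_poly_add[of "g - h" h a] by simp

text \<open>
  Horner's rule \<open>frob_poly_pCons\<close> reduces this to the action of constants and of \<open>x\<close>.
\<close>
lemma frob_poly_mult: "frob_poly (g * h) a = frob_poly g (frob_poly h a)"
  by (induction g)
     (simp_all add: mult_pCons_left frob_poly_add frob_poly_smult frob_poly_pCons)

lemma frob_poly_1: "frob_poly 1 a = a"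
  by (simp add: frob_poly_def)

lemma frob_poly_monom: "frob_poly (monom 1 i) a = a ^ (CARD('k) ^ i)"
  by (induction i) (simp_all add: monom_Suc frob_poly_pCons monom_0 frob_poly_1 mult.commute flip: power_mult)

lemma frob_poly_of_nat: "frob_poly (of_nat j) a = of_nat j * a"
  by (simp add: frob_poly_def of_nat_poly hom_of_nat)

text \<open>
  Every element of the large field is fixed by the \<open>n\<close>-th iterate of the Frobenius map.
\<close>
lemma frob_poly_period: "frob_poly (monom 1 n - 1) a = 0"
  by (simp add: frob_poly_1 frob_poly_diff frob_poly_monom power_CARD_eq_same flip: card_l)

lemma normal_over_iff_inj:
  "normal_over \<iota> n a \<longleftrightarrow> (\<forall>g\<in>polys_below n. frob_poly g a = 0 \<longrightarrow> g = 0)"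
proof -
  interpret V: Modules.module "\<lambda>c x. \<iota> c * x"
    by standard (simp_all add: hom_distribs algebra_simps)
  define F where "F = (\<lambda>i. a ^ (CARD('k) ^ i))"
  show ?thesis
  proof (intro iffI ballI impI)
    fix g assume "normal_over \<iota> n a" and g: "g \<in> polys_below n" "frob_poly g a = 0"
    then have inj: "inj_on F {..<n}" and indep: "\<not> V.dependent (F ` {..<n})"
      by (auto simp: normal_over_def F_def)
    define u where "u = (\<lambda>v. coeff g (the_inv_into {..<n} F v))"
    have u: "u (F i) = coeff g i" if "i < n" for i
      using that inj by (simp add: u_def the_inv_into_f_f)
    have "(\<Sum>v\<in>F ` {..<n}. \<iota> (u v) * v) = 0"
      using g by (simp add: sum.reindex[OF inj] u frob_poly_eq_sum flip: F_def[THEN fun_cong])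
    with indep have "\<forall>v\<in>F ` {..<n}. u v = 0"
      by (subst (asm) V.dependent_finite) auto
    then have "coeff g i = 0" for i
      using u g(1) by (cases "i < n") (auto simp: polys_below_def)
    then show "g = 0"
      by (simp add: poly_eq_iff)
  next
    assume inj: "\<forall>g\<in>polys_below n. frob_poly g a = 0 \<longrightarrow> g = 0"
    have inj_F: "inj_on F {..<n}"
    proof (rule inj_onI)
      fix i j assume "i \<in> {..<n}" "j \<in> {..<n}" "F i = F j"
      then have "monom 1 i - monom 1 j \<in> polys_below n" "frob_poly (monom 1 i - monom 1 j) a = 0"
        by (auto simp: polys_below_def frob_poly_diff frob_poly_monom F_def)
      with inj have "monom 1 i = (monom 1 j :: 'k poly)"
        by fastforce
      then show "i = j"
        by (simp add: monom_eq_iff')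
    qed
    have "u v = 0" if sum_0: "(\<Sum>v\<in>F ` {..<n}. \<iota> (u v) * v) = 0" and v: "v \<in> F ` {..<n}" for u v
    proof -
      define g where "g = (\<Sum>i<n. monom (u (F i)) i)"
      have coeff: "coeff g i = (if i < n then u (F i) else 0)" for i
        by (simp add: g_def coeff_sum)
      then have "g \<in> polys_below n"
        by (simp add: polys_below_def)
      moreover from this have "frob_poly g a = 0"
        using sum_0 by (simp add: sum.reindex[OF inj_F] frob_poly_eq_sum coeff flip: F_def[THEN fun_cong])
      ultimately have "g = 0"
        using inj by blast
      moreover obtain i where "i < n" "v = F i"
        using v by auto
      ultimately show ?thesis
        using coeff[of i] by simp
    qed
    with inj_F show "normal_over \<iota> n a"
      unfolding normal_over_def F_def[symmetric] by (subst V.dependent_finite) blast+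
  qed
qed

lemma period_degree: "degree (monom 1 n - 1 :: 'k poly) = n"
  using n_pos degree_add_eq_left[of "- 1" "monom (1::'k) n"] by (simp add: degree_monom_eq)

lemma period_nonzero: "(monom 1 n - 1 :: 'k poly) \<noteq> 0"
  using period_degree n_pos by force

lemma frob_poly_mod_period: "frob_poly (g mod (monom 1 n - 1)) a = frob_poly g a"
proof -
  let ?M = "monom 1 n - 1 :: 'k poly"
  have "frob_poly g a = frob_poly (g div ?M * ?M + g mod ?M) a"
    by (simp only: div_mult_mod_eq)
  also have "\<dots> = frob_poly (g div ?M) 0 + frob_poly (g mod ?M) a"
    by (simp only: frob_poly_add frob_poly_mult frob_poly_period)
  also have "frob_poly (g div ?M) 0 = 0"
    by (simp add: frob_poly_def zero_power)
  finally show ?thesis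
    by simp
qed

text \<open>
  Normality says that the annihilator of \<open>a\<close> in the polynomial ring is as small as it can be,
  namely the ideal generated by \<open>x^n - 1\<close>, which annihilates everything.
\<close>
lemma normal_over_iff_annihilator:
  "normal_over \<iota> n a \<longleftrightarrow> (\<forall>g. frob_poly g a = 0 \<longrightarrow> monom 1 n - 1 dvd g)"
proof -
  let ?M = "monom 1 n - 1 :: 'k poly"
  have "g mod ?M \<in> polys_below n" for g
    using mod_in_polys_below[OF period_nonzero] by (simp add: period_degree)
  moreover have "g = 0" if "g \<in> polys_below n" "?M dvd g" for g
    using polys_below_dvd_imp_0[of g ?M] that by (simp add: period_degree)
  ultimately show ?thesis
    unfolding normal_over_iff_inj by (metis frob_poly_mod_period mod_eq_0_iff_dvd)
qed

text \<open>
  Surjectivity is a matter of size: both sides have \<open>CARD('k) ^ n\<close> elements.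
\<close>
lemma bij_betw_frob_poly:
  assumes "normal_over \<iota> n \<alpha>"
  shows "bij_betw (\<lambda>g. frob_poly g \<alpha>) (polys_below n) UNIV"
proof (rule bij_betw_if_inj_on_card)
  show "inj_on (\<lambda>g. frob_poly g \<alpha>) (polys_below n)"
  proof (rule inj_onI)
    fix g h assume "g \<in> polys_below n" "h \<in> polys_below n" "frob_poly g \<alpha> = frob_poly h \<alpha>"
    then have "g - h \<in> polys_below n" "frob_poly (g - h) \<alpha> = 0"
      by (simp_all add: polys_below_diff frob_poly_diff)
    with assms show "g = h"
      unfolding normal_over_iff_inj by fastforce
  qed
qed (simp_all add: card_polys_below card_l)

text \<open>
  The annihilator of \<open>frob_poly g \<alpha>\<close> consists of the \<open>h\<close> for which \<open>x^n - 1\<close> divides \<open>h * g\<close>. It is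
  generated by \<open>x^n - 1\<close> iff \<open>g\<close> can be cancelled modulo \<open>x^n - 1\<close>, that is, iff \<open>g\<close> is prime to all
  factors \<open>f i\<close>.
\<close>
lemma normal_over_frob_poly_iff:
  assumes "normal_over \<iota> n \<alpha>"
    and "monom 1 n - 1 = (\<Prod>i\<in>I. f i ^ k)" and "k > 0" and "finite I"
    and "\<And>i. i \<in> I \<Longrightarrow> prime_elem (f i)"
  shows "normal_over \<iota> n (frob_poly g \<alpha>) \<longleftrightarrow> (\<forall>i\<in>I. \<not> f i dvd g)"
proof -
  let ?M = "monom 1 n - 1 :: 'k poly"
  have iff: "frob_poly (h * g) \<alpha> = 0 \<longleftrightarrow> ?M dvd h * g" for h
    using assms(1) unfolding normal_over_iff_annihilator
    by (metis frob_poly_0 frob_poly_mod_period mod_eq_0_iff_dvd)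
  then have normal_iff: "normal_over \<iota> n (frob_poly g \<alpha>) \<longleftrightarrow> (\<forall>h. ?M dvd h * g \<longrightarrow> ?M dvd h)"
    unfolding normal_over_iff_annihilator by (simp flip: frob_poly_mult)
  show ?thesis
  proof
    assume cancel: "normal_over \<iota> n (frob_poly g \<alpha>)"
    show "\<forall>i\<in>I. \<not> f i dvd g"
    proof (intro ballI notI)
      fix i assume i: "i \<in> I" "f i dvd g"
      have "f i dvd ?M"
        using i(1) assms(2-4) by (metis dvd_power dvd_prodI dvd_trans)
      \<comment> \<open>The cofactor of \<open>f i\<close> annihilates \<open>frob_poly g \<alpha>\<close> but is too small to be a multiple of \<open>x^n - 1\<close>.\<close>
      then obtain h where h: "?M = h * f i"
        by (metis dvdE mult.commute)
      have "?M dvd h * g"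
        unfolding h using i(2) by (intro mult_dvd_mono) auto
      with cancel normal_iff have "?M dvd h"
        by blast
      then have "h * f i dvd h * 1"
        unfolding h by simp
      moreover have "h \<noteq> 0"
        using h period_nonzero by auto
      ultimately have "f i dvd 1"
        using dvd_times_left_cancel_iff[of h "f i" 1] by blast
      then show False
        using assms(5)[OF i(1)] using prime_elem_not_unit by blast
    qed
  next
    assume ndvd: "\<forall>i\<in>I. \<not> f i dvd g"
    \<comment> \<open>Coprimality to \<open>g\<close>, in a form that is closed under products.\<close>
    define cancels where "cancels = (\<lambda>M :: 'k poly. M \<noteq> 0 \<and> (\<forall>h. M dvd h * g \<longrightarrow> M dvd h))"
    have mult: "cancels (M * N)" if "cancels M" "cancels N" for M N
      unfolding cancels_def
    proof (intro conjI allI impI)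
      fix h assume *: "M * N dvd h * g"
      have "M dvd h"
        using that(1) dvd_mult_left[OF *] unfolding cancels_def by blast
      then obtain h' where h': "h = M * h'"
        by (elim dvdE)
      have "M \<noteq> 0"
        using that(1) unfolding cancels_def by blast
      with * have "N dvd h' * g"
        unfolding h' mult.assoc using dvd_times_left_cancel_iff[of M N "h' * g"] by blast
      then have "N dvd h'"
        using that(2) unfolding cancels_def by blast
      then show "M * N dvd h"
        unfolding h' by (rule mult_dvd_mono[OF dvd_refl])
    qed (use that in \<open>simp add: cancels_def\<close>)
    have "cancels (f i)" if "i \<in> I" for i
      using assms(5) ndvd that
      by (auto simp: cancels_def prime_elem_dvd_mult_iff dest: prime_elem_not_zeroI)
    then have pow: "cancels (f i ^ l)" if "i \<in> I" for i l
      using that by (induction l) (auto simp: mult, simp add: cancels_def)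
    have "cancels (\<Prod>i\<in>J. f i ^ k)" if "finite J" "J \<subseteq> I" for J
      using that by (induction J) (auto simp: mult pow, simp add: cancels_def)
    from this[OF assms(4) subset_refl] have "cancels ?M"
      unfolding assms(2) .
    then show "normal_over \<iota> n (frob_poly g \<alpha>)"
      unfolding normal_iff cancels_def by blast
  qed
qed

text \<open>
  On the polynomial side, applying the Frobenius map \<open>e\<close> times is multiplication by \<open>x^e\<close>, and
  subtracting \<open>j * \<alpha>\<close> is subtracting the constant \<open>j\<close>. The condition at \<open>i\<close> is stated for the residue
  of \<open>g\<close> modulo \<open>f i\<close>, so that the conditions can be counted separately.
\<close>
lemma sociable_frob_poly_iff:
  assumes "normal_over \<iota> n \<alpha>"
    and "monom 1 n - 1 = (\<Prod>i\<in>I. f i ^ k)" and "k > 0" and "finite I"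
    and "\<And>i. i \<in> I \<Longrightarrow> prime_elem (f i)"
  shows "sociable \<iota> n \<alpha> b (frob_poly g \<alpha>) \<longleftrightarrow>
           (\<forall>i\<in>I. \<not> (\<exists>e. \<exists>j<b. f i dvd monom 1 e * (g mod f i) - of_nat j))"
proof -
  have "frob_poly g \<alpha> ^ (CARD('k) ^ e) - of_nat j * \<alpha> = frob_poly (monom 1 e * g - of_nat j) \<alpha>" for e j
    by (simp add: frob_poly_diff frob_poly_mult frob_poly_monom frob_poly_of_nat)
  moreover have "f i dvd monom 1 e * g - of_nat j \<longleftrightarrow> f i dvd monom 1 e * (g mod f i) - of_nat j" for i e j
    by (simp add: mod_mult_right_eq flip: mod_eq_dvd_iff)
  ultimately show ?thesis
    unfolding sociable_def has_normal_depth_def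
    by (simp add: normal_over_frob_poly_iff[OF assms]) blast
qed

end

section \<open>Residues excluded by sociability\<close>

text \<open>
  The polynomials that vanish at \<open>\<theta>\<close> form an ideal. A nonzero element \<open>d\<close> of least degree divides all
  others by division with remainder; it divides \<open>f\<close> without being a unit, so it is associated with
  \<open>f\<close>.
\<close>
lemma (in field_hom) poly_map_poly_eq_0_iff_dvd:
  assumes "irreducible f" and "poly (map_poly hom f) \<theta> = 0"
  shows "poly (map_poly hom g) \<theta> = 0 \<longleftrightarrow> f dvd g"
proof -
  interpret map_poly: map_poly_idom_hom hom ..
  show ?thesis
  proof
    assume g: "poly (map_poly hom g) \<theta> = 0"
    define P where "P = (\<lambda>d. d \<noteq> 0 \<and> poly (map_poly hom d) \<theta> = 0)"
    have "P f"
      using assms by (auto simp: P_def)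
    then obtain d where d: "P d" and min: "\<And>d'. P d' \<Longrightarrow> degree d \<le> degree d'"
      using ex_has_least_nat[of P f degree] by blast
    have d_dvd: "d dvd h" if "poly (map_poly hom h) \<theta> = 0" for h
    proof (rule ccontr)
      assume ndvd: "\<not> d dvd h"
      have "map_poly hom h = map_poly hom (h div d * d + h mod d)"
        by (simp only: div_mult_mod_eq)
      also have "\<dots> = map_poly hom (h div d) * map_poly hom d + map_poly hom (h mod d)"
        by (simp only: map_poly.hom_add map_poly.hom_mult)
      finally have "poly (map_poly hom (h mod d)) \<theta> = 0"
        using that d by (simp add: P_def)
      then have "degree d \<le> degree (h mod d)"
        using ndvd by (intro min) (simp add: P_def mod_eq_0_iff_dvd)
      moreover have "degree (h mod d) < degree d"
        using ndvd d degree_mod_less[of d h] by (auto simp: P_def mod_eq_0_iff_dvd)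
      ultimately show False
        by simp
    qed
    obtain e where e: "f = d * e"
      using d_dvd[OF assms(2)] by (elim dvdE)
    have "\<not> d dvd 1"
    proof
      assume "d dvd 1"
      then obtain k where "1 = d * k"
        by (elim dvdE)
      then have "poly (map_poly hom 1) \<theta> = poly (map_poly hom (d * k)) \<theta>"
        by simp
      then show False
        using d by (simp add: P_def map_poly.hom_mult)
    qed
    with assms(1) e have "e dvd 1"
      using irreducibleD by blast
    then have "f dvd d"
      unfolding e by simp
    with d_dvd[OF g] show "f dvd g"
      by (rule dvd_trans[rotated])
  next
    assume "f dvd g"
    then show "poly (map_poly hom g) \<theta> = 0"
      using assms(2) by (auto simp: map_poly.hom_mult elim!: dvdE)
  qed
qed

lemma inj_on_of_nat_below_CHAR:
  "inj_on (of_nat :: nat \<Rightarrow> 'a::ring_1) {..<CHAR('a)}"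
proof (rule linorder_inj_onI')
  fix i j assume "j \<in> {..<CHAR('a)}" and "i < j"
  then have "\<not> CHAR('a) dvd j - i"
    by (auto dest: dvd_imp_le)
  then have "of_nat (j - i) \<noteq> (0 :: 'a)"
    by (simp only: of_nat_eq_0_iff_char_dvd not_False_eq_True)
  with \<open>i < j\<close> show "of_nat i \<noteq> (of_nat j :: 'a)"
    by (simp add: of_nat_diff)
qed

text \<open>
  Evaluation at \<open>\<theta>\<close> is injective on residues modulo \<open>f\<close> and turns the excluded ones into the values
  \<open>j * \<theta> ^ i\<close> with \<open>j < b\<close>. All values with \<open>j = 0\<close> coincide, which gives the summand \<open>1\<close>; the
  others are nonzero and pairwise distinct.
\<close>
lemma card_excluded_residues:
  fixes \<kappa> :: "'k::{field,finite} \<Rightarrow> 'm::field"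
  assumes "field_hom \<kappa>" and "irreducible f" and "poly (map_poly \<kappa> f) \<theta> = 0"
    and "\<theta> ^ n = 1" and "n > 0" and "coprime n (CARD('k) - 1)"
    and "b \<ge> 1" and "b \<le> CHAR('k)"
  shows "card {h \<in> polys_below (degree f). \<exists>e. \<exists>j<b. f dvd monom 1 e * h - of_nat j} =
           1 + (b - 1) * mult_order \<theta>"
proof -
  interpret field_hom \<kappa> by fact
  interpret map_poly: map_poly_idom_hom \<kappa> ..
  define ev where "ev = (\<lambda>h. poly (map_poly \<kappa> h) \<theta>)"
  have ev_eq_0_iff: "ev h = 0 \<longleftrightarrow> f dvd h" for h
    unfolding ev_def by (rule poly_map_poly_eq_0_iff_dvd) fact+
  have ev_diff: "ev (g - h) = ev g - ev h" for g h
    by (simp add: ev_def map_poly.hom_minus)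
  have ev_monom_mult: "ev (monom 1 e * h - of_nat j) = \<theta> ^ e * ev h - of_nat j" for e h j
    by (simp add: ev_def map_poly.hom_minus map_poly.hom_mult map_poly.hom_of_nat poly_monom)
  \<comment> \<open>An inverse of \<open>\<theta> ^ e\<close> that is again a power of \<open>\<theta>\<close> with a natural exponent.\<close>
  have inverse: "\<theta> ^ (e * (n - 1)) * \<theta> ^ e = 1" for e
  proof -
    have "\<theta> ^ (e * (n - 1)) * \<theta> ^ e = (\<theta> ^ n) ^ e"
      using assms(5) by (simp flip: power_add power_mult add: algebra_simps)
    then show ?thesis
      by (simp add: assms(4))
  qed
  let ?E = "{h \<in> polys_below (degree f). \<exists>e. \<exists>j<b. f dvd monom 1 e * h - of_nat j}"
  let ?J = "{1..<b} \<times> {..<mult_order \<theta>}"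
  define \<psi> where "\<psi> = (\<lambda>(j, i). of_nat j * \<theta> ^ i)"
  have E: "?E = {h \<in> polys_below (degree f). \<exists>e. \<exists>j<b. \<theta> ^ e * ev h = of_nat j}"
    by (simp add: ev_monom_mult flip: ev_eq_0_iff)
  have "inj_on ev (polys_below (degree f))"
  proof (rule inj_onI)
    fix g h assume "g \<in> polys_below (degree f)" "h \<in> polys_below (degree f)" "ev g = ev h"
    then have "g - h = 0"
      by (intro polys_below_dvd_imp_0[of _ f]) (simp_all add: polys_below_diff ev_diff flip: ev_eq_0_iff)
    then show "g = h"
      by simp
  qed
  then have "card ?E = card (ev ` ?E)"
    by (intro card_image[symmetric]) (auto simp: inj_on_def)
  also have "ev ` ?E = insert 0 (\<psi> ` ?J)"
  proof (intro equalityI subsetI)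
    fix y assume "y \<in> ev ` ?E"
    then obtain e j where ej: "j < b" "\<theta> ^ e * y = of_nat j"
      by (auto simp: E)
    define i where "i = e * (n - 1) mod mult_order \<theta>"
    have "y = \<theta> ^ (e * (n - 1)) * \<theta> ^ e * y"
      by (simp only: inverse mult_1_left)
    also have "\<dots> = of_nat j * \<theta> ^ (e * (n - 1))"
      unfolding mult.assoc ej(2) by (rule mult.commute)
    also have "\<theta> ^ (e * (n - 1)) = \<theta> ^ i"
      unfolding i_def by (rule power_mod_mult_order[OF assms(4,5), symmetric])
    finally have "y = \<psi> (j, i)"
      by (simp add: \<psi>_def)
    moreover have "i < mult_order \<theta>"
      using mult_order_pos[OF assms(4,5)] by (simp add: i_def)
    ultimately show "y \<in> insert 0 (\<psi> ` ?J)"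
      using ej(1) by (cases "j = 0") (auto simp: \<psi>_def)
  next
    fix y assume y: "y \<in> insert 0 (\<psi> ` ?J)"
    obtain j i where ji: "j < b" "y = of_nat j * \<theta> ^ i"
    proof (cases "y = 0")
      case True
      then show ?thesis
        using that[of 0 0] assms(7) by simp
    next
      case False
      with y show ?thesis
        by (auto simp: \<psi>_def intro: that)
    qed
    define h where "h = monom (of_nat j) i mod f"
    have "f dvd monom (of_nat j) i - h"
      by (simp add: h_def)
    then have "ev h = ev (monom (of_nat j) i)"
      by (simp add: ev_diff flip: ev_eq_0_iff)
    also have "\<dots> = y"
      by (simp add: ev_def ji(2) poly_monom hom_of_nat)
    finally have "ev h = y" .
    moreover have "h \<in> polys_below (degree f)"
      using assms(2) unfolding h_def by (intro mod_in_polys_below) auto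
    moreover have "\<theta> ^ (i * (n - 1)) * y = of_nat j"
      using inverse[of i] by (simp add: ji(2) mult.left_commute)
    ultimately show "y \<in> ev ` ?E"
      unfolding E using ji(1) by blast
  qed
  also have "card \<dots> = 1 + card ?J"
  proof -
    have inj_of_nat: "j = j'" if "j < b" "j' < b" "of_nat j = (of_nat j' :: 'k)" for j j'
      using inj_on_of_nat_below_CHAR[where ?'a = 'k] that assms(8) by (auto simp: inj_on_def)
    have nz: "of_nat j \<noteq> (0 :: 'm)" if "j \<in> {1..<b}" for j
    proof
      assume "of_nat j = (0 :: 'm)"
      then have "of_nat j = (of_nat 0 :: 'k)"
        by (simp flip: hom_of_nat)
      with that inj_of_nat[of j 0] show False
        by simp
    qed
    have theta_nz: "\<theta> \<noteq> 0"
      using assms(4,5) by (auto simp: zero_power)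
    have "inj_on \<psi> ?J"
    proof (rule inj_onI)
      fix x x' assume x: "x \<in> ?J" "x' \<in> ?J" "\<psi> x = \<psi> x'"
      obtain j i j' i' where [simp]: "x = (j, i)" "x' = (j', i')"
        by (cases x, cases x')
      from x have j: "j \<in> {1..<b}" "j' \<in> {1..<b}"
        and i: "i \<in> {..<mult_order \<theta>}" "i' \<in> {..<mult_order \<theta>}"
        and eq: "\<psi> (j, i) = \<psi> (j', i')"
        by simp_all
      have theta_pow: "(\<theta> ^ k) ^ n = 1" for k
        using assms(4) by (metis mult.commute power_mult power_one)
      \<comment> \<open>Raising to the \<open>n\<close>-th power removes \<open>\<theta>\<close>, so \<open>j / j'\<close> is an \<open>n\<close>-th root of unity in the base field.\<close>
      have "(of_nat j * \<theta> ^ i) ^ n = (of_nat j' * \<theta> ^ i') ^ n"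
        using eq by (simp add: \<psi>_def)
      then have "\<kappa> (of_nat j ^ n) = \<kappa> (of_nat j' ^ n)"
        by (simp add: power_mult_distrib theta_pow hom_power hom_mult hom_of_nat)
      then have eq_pow: "(of_nat j ^ n :: 'k) = of_nat j' ^ n"
        by simp
      define c where "c = (of_nat j / of_nat j' :: 'k)"
      have nz': "of_nat j \<noteq> (0 :: 'k)" "of_nat j' \<noteq> (0 :: 'k)"
        using nz[OF j(1)] nz[OF j(2)] by (auto simp flip: hom_of_nat)
      then have "c ^ n = 1" "c \<noteq> 0"
        using eq_pow by (simp_all add: c_def power_divide)
      then have "c = 1"
        using assms(6) power_CARD_minus_1_eq_1 by (blast intro: eq_1_if_powers_eq_1_coprime)
      then have "of_nat j = (of_nat j' :: 'k)"
        using nz' by (simp add: c_def)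
      then have "j = j'"
        using j by (intro inj_of_nat) auto
      moreover have "i = i'"
      proof (rule inj_onD[OF inj_on_power_mult_order[OF assms(4,5)] _ i])
        show "\<theta> ^ i = \<theta> ^ i'"
          using eq \<open>j = j'\<close> nz[OF j(1)] by (simp add: \<psi>_def)
      qed
      ultimately show "x = x'"
        by simp
    qed
    moreover have "0 \<notin> \<psi> ` ?J"
      using nz theta_nz by (force simp: \<psi>_def)
    ultimately show ?thesis
      by (simp add: card_image)
  qed
  finally show ?thesis
    by (simp add: card_cartesian_product)
qed

section \<open>The number of sociable elements\<close>

theorem proposition6:
  fixes \<iota> :: "'k::{field,finite} \<Rightarrow> 'l::{field,finite}"
    and \<kappa> :: "'k \<Rightarrow> 'm::field"
    and p q m n \<tau> r b :: nat
    and f :: "nat \<Rightarrow> 'k poly"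
    and \<theta> :: "nat \<Rightarrow> 'm"
    and \<alpha> :: 'l
  assumes "prime p" and "q = p ^ m" and "CARD('k) = q"
    and "n \<ge> 1"
    and "field_hom \<iota>" and "CARD('l) = q ^ n"
    and "\<tau> = p ^ multiplicity p n"
    and "monom 1 n - 1 = (\<Prod>i\<in>{1..r}. f i ^ \<tau>)"
    and "inj_on f {1..r}"
    and "\<And>i. i \<in> {1..r} \<Longrightarrow> lead_coeff (f i) = 1 \<and> irreducible (f i)"
    and "field_hom \<kappa>"
    and "\<And>i. i \<in> {1..r} \<Longrightarrow> poly (map_poly \<kappa> (f i)) (\<theta> i) = 0"
    and "normal_over \<iota> n \<alpha>"
    and "1 \<le> b" and "b \<le> p"
    and "gcd n (q - 1) = 1"
  shows "int (card {\<beta> :: 'l. sociable \<iota> n \<alpha> b \<beta>}) =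
           int q ^ (n * (\<tau> - 1) div \<tau>) *
           (\<Prod>i\<in>{1..r}. int q ^ degree (f i) - (int b - 1) * int (mult_order (\<theta> i)) - 1)"
proof -
  interpret iota: field_hom \<iota> by fact
  interpret finite_field_extension \<iota> p m n
    by standard (simp_all add: assms(1,2,3,6))
  interpret kappa: field_hom \<kappa> by fact
  interpret map_kappa: map_poly_idom_hom \<kappa> ..
  define I where "I = {1..r}"
  define F where "F = prod f I"
  have fin: "finite I"
    by (simp add: I_def)
  have irred: "irreducible (f i)" and monic: "lead_coeff (f i) = 1"
    and root: "poly (map_poly \<kappa> (f i)) (\<theta> i) = 0" if "i \<in> I" for i
    using that assms(10,12) by (auto simp: I_def)
  have prime: "prime_elem (f i)" if "i \<in> I" for i
    using irred[OF that] by (rule field_poly_irreducible_imp_prime)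
  have nonzero: "f i \<noteq> 0" if "i \<in> I" for i
    using prime[OF that] by (rule prime_elem_not_zeroI)
  have tau_pos: "\<tau> > 0"
    using assms(1,7) by (simp add: prime_gt_0_nat)
  have factorization: "monom 1 n - 1 = (\<Prod>i\<in>I. f i ^ \<tau>)"
    using assms(8) by (simp add: I_def)

  \<comment> \<open>Two monic irreducible polynomials that divide one another differ by a constant factor, which is \<open>1\<close>.\<close>
  have distinct: "\<not> f i dvd f j" if ij: "i \<in> I" "j \<in> I" "i \<noteq> j" for i j
  proof
    assume "f i dvd f j"
    then obtain e where e: "f j = f i * e"
      by (elim dvdE)
    have "\<not> f i dvd 1"
      using irred[OF ij(1)] irreducible_not_unit by blast
    then have "e dvd 1"
      using irreducibleD[OF irred[OF ij(2)] e] by blast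
    then have "degree e = 0"
      by (simp add: poly_dvd_1)
    then obtain c where c: "e = [:c:]"
      by (elim degree_eq_zeroE)
    have "lead_coeff (f j) = lead_coeff (f i) * lead_coeff e"
      unfolding e by (rule lead_coeff_mult)
    then have "c = 1"
      unfolding monic[OF ij(1)] monic[OF ij(2)] c by simp
    then have "f j = f i"
      unfolding e c by simp
    then have "j = i"
      using inj_onD[OF assms(9)] ij(1,2) unfolding I_def by blast
    with ij(3) show False
      by simp
  qed

  have F_nonzero: "F \<noteq> 0"
    using nonzero by (simp add: F_def fin)
  have "monom 1 n - 1 = F ^ \<tau>"
    by (simp add: factorization F_def prod_power_distrib)
  then have degree_F: "n = degree F * \<tau>"
    using period_degree by (simp add: degree_power_eq F_nonzero)

  have theta: "\<theta> i ^ n = 1" if "i \<in> I" for i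
  proof -
    have "f i dvd monom 1 n - 1"
      unfolding factorization using that fin tau_pos by (metis dvd_power dvd_prodI dvd_trans)
    then have "poly (map_poly \<kappa> (monom 1 n - 1)) (\<theta> i) = 0"
      using kappa.poly_map_poly_eq_0_iff_dvd[OF irred[OF that] root[OF that]] by blast
    then show ?thesis
      by (simp add: map_kappa.hom_minus poly_monom)
  qed

  define E where "E = (\<lambda>i. {h \<in> polys_below (degree (f i)).
    \<exists>e. \<exists>j<b. f i dvd monom 1 e * h - of_nat j})"
  define A where "A = (\<lambda>i. polys_below (degree (f i)) - E i)"
  define B where "B = {h \<in> polys_below (degree F). \<forall>i\<in>I. h mod f i \<in> A i}"

  have card_A: "int (card (A i)) = int q ^ degree (f i) - (int b - 1) * int (mult_order (\<theta> i)) - 1"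
    if "i \<in> I" for i
  proof -
    have "card (E i) = 1 + (b - 1) * mult_order (\<theta> i)"
      unfolding E_def using theta[OF that] irred[OF that] root[OF that] assms(3,11,14,15,16) n_pos
      by (intro card_excluded_residues[of \<kappa> _ _ n]) (simp_all add: CHAR_k coprime_iff_gcd_eq_1)
    moreover have "E i \<subseteq> polys_below (degree (f i))"
      by (auto simp: E_def)
    moreover from this have "card (E i) \<le> q ^ degree (f i)"
      using card_mono[OF finite_polys_below] by (metis assms(3) card_polys_below)
    moreover have "card (A i) = q ^ degree (f i) - card (E i)"
      unfolding A_def using \<open>E i \<subseteq> _\<close>
      by (simp add: card_Diff_subset finite_subset[OF _ finite_polys_below] card_polys_below assms(3))
    ultimately show ?thesis
      using assms(14) by (simp add: of_nat_diff)
  qed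

  have sociable_iff: "sociable \<iota> n \<alpha> b (frob_poly g \<alpha>) \<longleftrightarrow> g mod F \<in> B" for g
  proof -
    have "g mod F mod f i = g mod f i" if "i \<in> I" for i
      using that fin unfolding F_def by (intro mod_mod_cancel dvd_prodI)
    then have "g mod F \<in> B \<longleftrightarrow> (\<forall>i\<in>I. g mod f i \<notin> E i)"
      using F_nonzero nonzero by (auto simp: A_def B_def mod_in_polys_below)
    also have "\<dots> \<longleftrightarrow> sociable \<iota> n \<alpha> b (frob_poly g \<alpha>)"
      using nonzero by (simp add: E_def mod_in_polys_below
          sociable_frob_poly_iff[OF assms(13) factorization tau_pos fin prime])
    finally show ?thesis ..
  qed

  have bij: "bij_betw (\<lambda>g. frob_poly g \<alpha>) (polys_below n) UNIV"
    by (rule bij_betw_frob_poly) fact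
  have "card {\<beta>. sociable \<iota> n \<alpha> b \<beta>} = card {g \<in> polys_below n. g mod F \<in> B}"
    using card_preimage_bij_betw[OF bij, of "{\<beta>. sociable \<iota> n \<alpha> b \<beta>}"]
    by (simp add: sociable_iff)
  also have "\<dots> = q ^ (n - degree F) * card B"
    using F_nonzero degree_F tau_pos assms(3)
    by (subst card_residue_lifts) (auto simp: B_def)
  also have "card B = (\<Prod>i\<in>I. card (A i))"
    unfolding B_def F_def using fin prime distinct
    by (intro card_residue_conditions) (auto simp: A_def)
  also have "n - degree F = n * (\<tau> - 1) div \<tau>"
  proof -
    have "n * (\<tau> - 1) = degree F * (\<tau> - 1) * \<tau>"
      by (simp add: degree_F)
    then show ?thesis
      using tau_pos by (simp add: degree_F diff_mult_distrib2)
  qed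
  finally have "int (card {\<beta>. sociable \<iota> n \<alpha> b \<beta>}) =
      int q ^ (n * (\<tau> - 1) div \<tau>) * (\<Prod>i\<in>I. int (card (A i)))"
    by simp
  also have "(\<Prod>i\<in>I. int (card (A i))) =
      (\<Prod>i\<in>{1..r}. int q ^ degree (f i) - (int b - 1) * int (mult_order (\<theta> i)) - 1)"
    using card_A by (intro prod.cong) (simp_all add: I_def)
  finally show ?thesis .
qed

end
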